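(* Let $S_{\boldsymbol\lambda}\in\boldsymbol B(\ell^2(V))$ be a weighted shift on a directed tree $\mathcal T=(V,E)$ with weights $\boldsymbol\lambda=\{\lambda_v\}_{v\in V^\circ}$. Then the following assertions are equivalent: (i) $S_{\boldsymbol\lambda}$ is hyponormal; (ii) for every $u\in V$, the following two conditions hold: $$\text{if }v\in\operatorname{Chi}(u)\text{ and }\|S_{\boldsymbol\lambda}e_v\|=0,\text{ then }\lambda_v=0,$$ $$\sum_{v\in\operatorname{Chi}^+_{\boldsymbol\lambda}(u)}\frac{|\lambda_v|^2}{\|S_{\boldsymbol\lambda}e_v\|^2}\le1,$$ where $\operatorname{Chi}^+_{\boldsymbol\lambda}(u)=\{v\in\operatorname{Chi}(u):\|S_{\boldsymbol\lambda}e_v\|>0\}$.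
   Context: A directed tree $\mathcal T=(V,E)$ consists of a nonempty set $V$ (of arbitrary cardinality) of vertices and a set $E\subseteq V\times V\setminus\{(v,v):v\in V\}$ of edges such that: (1) any two distinct vertices $u,v$ are joined by an undirected path, i.e. there are $v_1=u,\dots,v_n=v$ in $V$ ($n\ge 2$) with $(v_j,v_{j+1})\in E$ or $(v_{j+1},v_j)\in E$ for each $j<n$; (2) there is no circuit, i.e. no finite sequence of distinct vertices $u_1,\dots,u_n$ ($n\ge2$) with $(u_j,u_{j+1})\in E$ for $j<n$ and $(u_n,u_1)\in E$; (3) every vertex $v$ that is not a root has a unique vertex $\operatorname{par}(v)$ (its parent) with $(\operatorname{par}(v),v)\in E$; a root is a vertex $v$ for which there is no $u$ with $(u,v)\in E$. A directed tree has at most one root, denoted $\mathrm{root}$ when it exists. $V^\circ$ is $V$ with the root removed (and $V^\circ=V$ if $\mathcal T$ has no root). $\operatorname{Chi}(u)=\{v\in V:(u,v)\in E\}$. $\ell^2(V)$ is the Hilbert space of square summable complex functions on $V$, with orthonormal basis $\{e_u\}_{u\in V}$, $e_u$ being the indicator function of $\{u\}$. For $\boldsymbol\lambda=\{\lambda_v\}_{v\in V^\circ}\subseteq\mathbb C$ and $f\colon V\to\mathbb C$ put $(\Lambda f)(v)=\lambda_v f(\operatorname{par}(v))$ for $v\in V^\circ$ and $(\Lambda f)(\mathrm{root})=0$. The weighted shift $S_{\boldsymbol\lambda}$ is the operator in $\ell^2(V)$ with domain $\{f\in\ell^2(V):\Lambda f\in\ell^2(V)\}$ and $S_{\boldsymbol\lambda}f=\Lambda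 f$. One has $\|S_{\boldsymbol\lambda}e_u\|^2=\sum_{v\in\operatorname{Chi}(u)}|\lambda_v|^2$ (sums over the empty set are $0$). $\boldsymbol B(\mathcal H)$ denotes the bounded operators on $\mathcal H$ with domain $\mathcal H$. $A\in\boldsymbol B(\mathcal H)$ is hyponormal if $\|A^*f\|\le\|Af\|$ for all $f\in\mathcal H$. *)

theory Defs
  imports "HOL-Analysis.Infinite_Sum"
begin

definition roots :: "'v set \<Rightarrow> ('v \<times> 'v) set \<Rightarrow> 'v set" where
  "roots V E = {v \<in> V. \<not> (\<exists>u. (u, v) \<in> E)}"

locale directed_tree =
  fixes V :: "'v set" and E :: "('v \<times> 'v) set"
  assumes nonempty: "V \<noteq> {}"
    and edges: "E \<subseteq> V \<times> V - {(v, v) | v. v \<in> V}"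
    and connected: "\<And>u v. u \<in> V \<Longrightarrow> v \<in> V \<Longrightarrow> u \<noteq> v \<Longrightarrow>
      \<exists>vs. set vs \<subseteq> V \<and> length vs \<ge> 2 \<and> hd vs = u \<and> last vs = v \<and>
        (\<forall>j. Suc j < length vs \<longrightarrow>
          (vs ! j, vs ! Suc j) \<in> E \<or> (vs ! Suc j, vs ! j) \<in> E)"
    and no_circuit: "\<not> (\<exists>us. set us \<subseteq> V \<and> length us \<ge> 2 \<and> distinct us \<and>
      (\<forall>j. Suc j < length us \<longrightarrow> (us ! j, us ! Suc j) \<in> E) \<and> (last us, hd us) \<in> E)"
    and unique_parent: "\<And>v. v \<in> V \<Longrightarrow> v \<notin> roots V E \<Longrightarrow> \<exists>!u. (u, v) \<in> E"

text \<open>Specified only for vertices that are not roots.\<close>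

definition par :: "('v \<times> 'v) set \<Rightarrow> 'v \<Rightarrow> 'v" where
  "par E v = (THE u. (u, v) \<in> E)"

definition Chi :: "('v \<times> 'v) set \<Rightarrow> 'v \<Rightarrow> 'v set" where
  "Chi E u = {v. (u, v) \<in> E}"

text \<open>
  Functions on \<open>V\<close> are represented by total functions that vanish off \<open>V\<close>, so that
  equality in \<open>l2 V\<close> is equality of functions and \<open>indicator {u}\<close>, for \<open>u \<in> V\<close>, is the
  basis vector at \<open>u\<close>. The inner product is linear in its first argument.
\<close>

definition l2 :: "'v set \<Rightarrow> ('v \<Rightarrow> complex) set" where
  "l2 V = {f. (\<forall>v. v \<notin> V \<longrightarrow> f v = 0) \<and> (\<lambda>v. (cmod (f v))\<^sup>2) summable_on V}"

definition l2_inner :: "'v set \<Rightarrow> ('v \<Rightarrow> complex) \<Rightarrow> ('v \<Rightarrow> complex) \<Rightarrow> complex" where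
  "l2_inner V f g = (\<Sum>\<^sub>\<infinity>v\<in>V. f v * cnj (g v))"

definition l2_norm :: "'v set \<Rightarrow> ('v \<Rightarrow> complex) \<Rightarrow> real" where
  "l2_norm V f = sqrt (\<Sum>\<^sub>\<infinity>v\<in>V. (cmod (f v))\<^sup>2)"

text \<open>
  An operator in \<open>l2 V\<close> is given by its domain \<open>D\<close> and a map \<open>A\<close>, whose values
  outside \<open>D\<close> are irrelevant. The following says that it belongs to \<open>B(l2 V)\<close>.
\<close>

definition bounded_operator ::
    "'v set \<Rightarrow> ('v \<Rightarrow> complex) set \<Rightarrow> (('v \<Rightarrow> complex) \<Rightarrow> 'v \<Rightarrow> complex) \<Rightarrow> bool" where
  "bounded_operator V D A \<longleftrightarrow>
     D = l2 V \<and>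
     (\<forall>f\<in>D. A f \<in> l2 V) \<and>
     (\<forall>f\<in>D. \<forall>g\<in>D. A (\<lambda>v. f v + g v) = (\<lambda>v. A f v + A g v)) \<and>
     (\<forall>c. \<forall>f\<in>D. A (\<lambda>v. c * f v) = (\<lambda>v. c * A f v)) \<and>
     (\<exists>C. \<forall>f\<in>D. l2_norm V (A f) \<le> C * l2_norm V f)"

text \<open>
  For a bounded operator \<open>A\<close> and \<open>f \<in> l2 V\<close> the vector described here exists and is
  unique by the Riesz representation theorem.
\<close>

definition l2_adjoint ::
    "'v set \<Rightarrow> (('v \<Rightarrow> complex) \<Rightarrow> 'v \<Rightarrow> complex) \<Rightarrow> ('v \<Rightarrow> complex) \<Rightarrow> 'v \<Rightarrow> complex" where
  "l2_adjoint V A f =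
     (THE g. g \<in> l2 V \<and> (\<forall>h\<in>l2 V. l2_inner V (A h) f = l2_inner V h g))"

definition hyponormal ::
    "'v set \<Rightarrow> (('v \<Rightarrow> complex) \<Rightarrow> 'v \<Rightarrow> complex) \<Rightarrow> bool" where
  "hyponormal V A \<longleftrightarrow>
     (\<forall>f\<in>l2 V. l2_norm V (l2_adjoint V A f) \<le> l2_norm V (A f))"

text \<open>Only the weights at vertices of \<open>V - roots V E\<close> are used.\<close>

definition weighted_shift ::
    "'v set \<Rightarrow> ('v \<times> 'v) set \<Rightarrow> ('v \<Rightarrow> complex) \<Rightarrow> ('v \<Rightarrow> complex) \<Rightarrow> 'v \<Rightarrow> complex" where
  "weighted_shift V E lam f =
     (\<lambda>v. if v \<in> V - roots V E then lam v * f (par E v) else 0)"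

definition weighted_shift_dom ::
    "'v set \<Rightarrow> ('v \<times> 'v) set \<Rightarrow> ('v \<Rightarrow> complex) \<Rightarrow> ('v \<Rightarrow> complex) set" where
  "weighted_shift_dom V E lam = {f \<in> l2 V. weighted_shift V E lam f \<in> l2 V}"

definition Chi_plus ::
    "'v set \<Rightarrow> ('v \<times> 'v) set \<Rightarrow> ('v \<Rightarrow> complex) \<Rightarrow> 'v \<Rightarrow> 'v set" where
  "Chi_plus V E lam u =
     {v \<in> Chi E u. l2_norm V (weighted_shift V E lam (indicator {v})) > 0}"

end

theory Submission
  imports Defs "HOL-Analysis.L2_Norm"
begin

text \<open>
  The adjoint acts by \<open>(S* f)(u) = (\<Sum>w\<in>Chi u. cnj (lam w) * f w)\<close>, and \<open>\<parallel>S f\<parallel>\<^sup>2 = (\<Sum>u. n u * \<bar>f u\<bar>\<^sup>2)\<close>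
  with \<open>n u = \<parallel>S e\<^sub>u\<parallel>\<^sup>2\<close>. Since the sets of children are disjoint, hyponormality can be
  tested one set of siblings at a time. There, condition (ii) gives the estimate
  \<open>\<bar>(S* f)(u)\<bar>\<^sup>2 \<le> (\<Sum>w\<in>Chi u. n w * \<bar>f w\<bar>\<^sup>2)\<close> by the Cauchy-Schwarz inequality with weights \<open>n w\<close>, and
  conversely one tests with the extremal vectors \<open>(\<Sum>w\<in>F. (lam w / n w) * e\<^sub>w)\<close>, \<open>F\<close> finite.
\<close>

section \<open>Infinite sums\<close>

text \<open>The inequality 2|ab| \<le> a^2 + b^2 supplies a summable majorant.\<close>

lemma summable_on_mult_of_squares:
  fixes a b :: "'a \<Rightarrow> real"
  assumes "(\<lambda>x. (a x)\<^sup>2) summable_on A" "(\<lambda>x. (b x)\<^sup>2) summable_on A"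
  shows "(\<lambda>x. \<bar>a x\<bar> * \<bar>b x\<bar>) summable_on A"
proof (rule summable_on_comparison_test)
  show "(\<lambda>x. (a x)\<^sup>2 + (b x)\<^sup>2) summable_on A"
    using assms by (rule summable_on_add)
  show "\<bar>a x\<bar> * \<bar>b x\<bar> \<le> (a x)\<^sup>2 + (b x)\<^sup>2" for x
  proof -
    have "2 * (\<bar>a x\<bar> * \<bar>b x\<bar>) \<le> (a x)\<^sup>2 + (b x)\<^sup>2"
      using sum_squares_bound[of "\<bar>a x\<bar>" "\<bar>b x\<bar>"] by simp
    moreover have "0 \<le> \<bar>a x\<bar> * \<bar>b x\<bar>" by simp
    ultimately show ?thesis by linarith
  qed
qed simp

text \<open>Every finite partial sum obeys the finite inequality, whose right side is at most the
  product of the roots of the full sums. This uniform bound passes to the infinite sum.\<close>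

lemma infsum_Cauchy_Schwarz:
  fixes a b :: "'a \<Rightarrow> real"
  assumes a: "(\<lambda>x. (a x)\<^sup>2) summable_on A" and b: "(\<lambda>x. (b x)\<^sup>2) summable_on A"
  shows "(\<Sum>\<^sub>\<infinity>x\<in>A. \<bar>a x\<bar> * \<bar>b x\<bar>)\<^sup>2 \<le> (\<Sum>\<^sub>\<infinity>x\<in>A. (a x)\<^sup>2) * (\<Sum>\<^sub>\<infinity>x\<in>A. (b x)\<^sup>2)"
proof -
  let ?a = "\<Sum>\<^sub>\<infinity>x\<in>A. (a x)\<^sup>2" and ?b = "\<Sum>\<^sub>\<infinity>x\<in>A. (b x)\<^sup>2"
  have "(\<Sum>\<^sub>\<infinity>x\<in>A. \<bar>a x\<bar> * \<bar>b x\<bar>) \<le> sqrt ?a * sqrt ?b"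
  proof (rule infsum_le_finite_sums[OF summable_on_mult_of_squares[OF a b]])
    fix F assume F: "finite F" "F \<subseteq> A"
    have "(\<Sum>x\<in>F. \<bar>a x\<bar> * \<bar>b x\<bar>) \<le> L2_set a F * L2_set b F"
      by (rule L2_set_mult_ineq)
    also have "\<dots> \<le> sqrt ?a * sqrt ?b"
      unfolding L2_set_def
      by (intro mult_mono real_sqrt_le_mono finite_sum_le_infsum a b F)
        (auto intro!: infsum_nonneg sum_nonneg)
    finally show "(\<Sum>x\<in>F. \<bar>a x\<bar> * \<bar>b x\<bar>) \<le> sqrt ?a * sqrt ?b" .
  qed
  then have "(\<Sum>\<^sub>\<infinity>x\<in>A. \<bar>a x\<bar> * \<bar>b x\<bar>)\<^sup>2 \<le> (sqrt ?a * sqrt ?b)\<^sup>2"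
    by (intro power_mono infsum_nonneg) auto
  also have "\<dots> = ?a * ?b"
    by (simp add: power_mult_distrib infsum_nonneg)
  finally show ?thesis .
qed

lemma summable_on_mult_complex:
  fixes a b :: "'a \<Rightarrow> complex"
  assumes "(\<lambda>x. (cmod (a x))\<^sup>2) summable_on A" "(\<lambda>x. (cmod (b x))\<^sup>2) summable_on A"
  shows "(\<lambda>x. a x * b x) summable_on A"
  using summable_on_mult_of_squares[OF assms]
  by - (rule abs_summable_summable, simp add: norm_mult)

lemma infsum_Cauchy_Schwarz_complex:
  fixes a b :: "'a \<Rightarrow> complex"
  assumes "(\<lambda>x. (cmod (a x))\<^sup>2) summable_on A" "(\<lambda>x. (cmod (b x))\<^sup>2) summable_on A"
  shows "(cmod (\<Sum>\<^sub>\<infinity>x\<in>A. a x * b x))\<^sup>2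
    \<le> (\<Sum>\<^sub>\<infinity>x\<in>A. (cmod (a x))\<^sup>2) * (\<Sum>\<^sub>\<infinity>x\<in>A. (cmod (b x))\<^sup>2)"
proof -
  have "cmod (\<Sum>\<^sub>\<infinity>x\<in>A. a x * b x) \<le> (\<Sum>\<^sub>\<infinity>x\<in>A. cmod (a x * b x))"
    using summable_on_mult_of_squares[OF assms]
    by - (rule norm_infsum_bound, simp add: norm_mult)
  then have "(cmod (\<Sum>\<^sub>\<infinity>x\<in>A. a x * b x))\<^sup>2 \<le> (\<Sum>\<^sub>\<infinity>x\<in>A. \<bar>cmod (a x)\<bar> * \<bar>cmod (b x)\<bar>)\<^sup>2"
    by (intro power_mono) (simp_all add: norm_mult)
  also note infsum_Cauchy_Schwarz[OF assms]
  finally show ?thesis .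
qed

text \<open>In \<open>ennreal\<close> a divergent sum is infinite, whereas a real
  \<open>infsum\<close> would default to 0 and make the bound trivially true. An
  \<open>ennreal\<close> sum is the supremum of its finite partial sums, so the bound becomes one on
  finite sums of reals, the form used in both directions below.\<close>

lemma infsum_ennreal_le_one_iff:
  assumes "\<And>x. x \<in> A \<Longrightarrow> 0 \<le> r x"
  shows "(\<Sum>\<^sub>\<infinity>x\<in>A. ennreal (r x)) \<le> 1 \<longleftrightarrow> (\<forall>F. finite F \<and> F \<subseteq> A \<longrightarrow> sum r F \<le> 1)"
proof -
  have eq: "(\<Sum>x\<in>F. ennreal (r x)) \<le> 1 \<longleftrightarrow> sum r F \<le> 1" if "F \<subseteq> A" for F
  proof -
    have "(\<Sum>x\<in>F. ennreal (r x)) = ennreal (sum r F)"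
      using assms that by (intro sum_ennreal) auto
    then show ?thesis
      by (simp flip: ennreal_1)
  qed
  have "(\<Sum>\<^sub>\<infinity>x\<in>A. ennreal (r x)) \<le> 1
      \<longleftrightarrow> (\<forall>F. finite F \<and> F \<subseteq> A \<longrightarrow> (\<Sum>x\<in>F. ennreal (r x)) \<le> 1)"
    by (simp add: nonneg_infsum_complete SUP_le_iff)
  with eq show ?thesis by blast
qed

section \<open>The space \<open>l2 V\<close>\<close>

lemma l2_summable: "f \<in> l2 V \<Longrightarrow> A \<subseteq> V \<Longrightarrow> (\<lambda>v. (cmod (f v))\<^sup>2) summable_on A"
  by (auto simp: l2_def intro: summable_on_subset_banach)

lemma l2_norm_squared: "(l2_norm V f)\<^sup>2 = (\<Sum>\<^sub>\<infinity>v\<in>V. (cmod (f v))\<^sup>2)"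
  by (simp add: l2_norm_def infsum_nonneg)

lemma l2_norm_nonneg: "0 \<le> l2_norm V f"
  by (simp add: l2_norm_def infsum_nonneg)

lemma finite_support_in_l2:
  assumes "finite F" "F \<subseteq> V" "\<And>v. v \<notin> F \<Longrightarrow> f v = 0"
  shows "f \<in> l2 V"
proof -
  have "(\<lambda>v. (cmod (f v))\<^sup>2) summable_on F \<longleftrightarrow> (\<lambda>v. (cmod (f v))\<^sup>2) summable_on V"
    using assms by (intro summable_on_cong_neutral) auto
  with assms show ?thesis
    by (auto simp: l2_def)
qed

lemma infsum_finite_support:
  assumes "finite F" "F \<subseteq> A" "\<And>v. v \<in> A - F \<Longrightarrow> f v = 0"
  shows "infsum f A = sum f F"
proof -
  have "infsum f A = infsum f F"
    using assms by (intro infsum_cong_neutral) auto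
  with assms show ?thesis by simp
qed

lemma infsum_indicator:
  fixes f :: "'a \<Rightarrow> 'b::{real_normed_algebra_1}"
  assumes "u \<in> A"
  shows "(\<Sum>\<^sub>\<infinity>v\<in>A. indicator {u} v * f v) = f u"
  using assms infsum_finite_support[of "{u}" A "\<lambda>v. indicator {u} v * f v"]
  by (simp add: indicator_def)

lemma l2_norm_indicator: "u \<in> V \<Longrightarrow> l2_norm V (indicator {u}) = 1"
  using infsum_finite_support[of "{u}" V "\<lambda>v. (cmod (indicator {u} v))\<^sup>2"]
  by (simp add: l2_norm_def)

text \<open>Testing against \<open>indicator {u}\<close> recovers the value at \<open>u\<close>, and
  vectors of \<open>l2 V\<close> vanish off \<open>V\<close>. Hence at most one vector fits the
  description, and exhibiting one suffices, without the Riesz theorem.\<close>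

lemma l2_adjoint_eqI:
  assumes g: "g \<in> l2 V" and eq: "\<And>h. h \<in> l2 V \<Longrightarrow> l2_inner V (A h) f = l2_inner V h g"
  shows "l2_adjoint V A f = g"
  unfolding l2_adjoint_def
proof (rule the_equality)
  fix g' assume g': "g' \<in> l2 V \<and> (\<forall>h\<in>l2 V. l2_inner V (A h) f = l2_inner V h g')"
  show "g' = g"
  proof
    fix u
    show "g' u = g u"
    proof (cases "u \<in> V")
      case True
      then have "indicator {u} \<in> l2 V"
        by (intro finite_support_in_l2[of "{u}"]) auto
      then have "l2_inner V (indicator {u}) g' = l2_inner V (indicator {u}) g"
        using g' eq by metis
      with True show ?thesis
        by (simp add: l2_inner_def infsum_indicator)
    next
      case False
      with g g' show ?thesis by (simp add: l2_def)
    qed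
  qed
qed (use assms in auto)

section \<open>Summation over siblings\<close>

context directed_tree
begin

lemma parent_in_tree: "w \<in> Chi E u \<Longrightarrow> u \<in> V"
  and child_not_root: "w \<in> Chi E u \<Longrightarrow> w \<in> V - roots V E"
  using edges by (auto simp: Chi_def roots_def)

lemma Chi_subset: "Chi E u \<subseteq> V"
  using child_not_root by blast

text \<open>The sets of children are the fibres of \<open>par E\<close> over the vertices that are
  not roots. Disjointness of sibling sets thus comes from uniqueness of parents.\<close>

lemma in_Chi_iff: "w \<in> Chi E u \<longleftrightarrow> w \<in> V - roots V E \<and> par E w = u"
proof -
  have "(par E w, w) \<in> E \<and> (\<forall>u. (u, w) \<in> E \<longrightarrow> u = par E w)" if "w \<in> V - roots V E"
    using unique_parent[of w] that theI'[of "\<lambda>u. (u, w) \<in> E"] unfolding par_def by blast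
  with child_not_root[of w u] show ?thesis
    by (auto simp: Chi_def)
qed

lemma par_Chi: "w \<in> Chi E u \<Longrightarrow> par E w = u"
  by (simp add: in_Chi_iff)

text \<open>The inverse pairs each vertex with its parent. This makes the non-root vertices the
  disjoint union of the sibling sets, so that sums over them can be grouped by parent.\<close>

lemma bij_betw_Sigma_Chi: "bij_betw snd (Sigma V (Chi E)) (V - roots V E)"
proof (rule bij_betw_byWitness[where f' = "\<lambda>w. (par E w, w)"])
  show "(\<lambda>w. (par E w, w)) ` (V - roots V E) \<subseteq> Sigma V (Chi E)"
  proof
    fix p assume "p \<in> (\<lambda>w. (par E w, w)) ` (V - roots V E)"
    then obtain w where w: "p = (par E w, w)" "w \<in> Chi E (par E w)"
      by (auto simp: in_Chi_iff)
    with parent_in_tree[OF w(2)] show "p \<in> Sigma V (Chi E)" by simp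
  qed
qed (use par_Chi child_not_root in auto)

text \<open>Summation over the disjoint union is iterated and then reindexed along the bijection
  above. Vertices without children contribute empty inner sums.\<close>

lemma
  fixes \<phi> :: "'v \<Rightarrow> 'b::banach"
  assumes "\<phi> summable_on V - roots V E"
  shows infsum_siblings: "(\<Sum>\<^sub>\<infinity>u\<in>V. \<Sum>\<^sub>\<infinity>w\<in>Chi E u. \<phi> w) = infsum \<phi> (V - roots V E)"
    and summable_on_siblings: "(\<lambda>u. \<Sum>\<^sub>\<infinity>w\<in>Chi E u. \<phi> w) summable_on V"
proof -
  have s: "(\<lambda>p. \<phi> (snd p)) summable_on Sigma V (Chi E)"
    using assms by (simp add: summable_on_reindex_bij_betw[OF bij_betw_Sigma_Chi])
  show "(\<Sum>\<^sub>\<infinity>u\<in>V. \<Sum>\<^sub>\<infinity>w\<in>Chi E u. \<phi> w) = infsum \<phi> (V - roots V E)"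
    using infsum_Sigma_banach[OF s] infsum_reindex_bij_betw[OF bij_betw_Sigma_Chi, of \<phi>] by simp
  show "(\<lambda>u. \<Sum>\<^sub>\<infinity>w\<in>Chi E u. \<phi> w) summable_on V"
    using summable_on_Sigma_banach[of "\<lambda>u w. \<phi> w" V "Chi E"] s by (simp add: case_prod_unfold)
qed

end

section \<open>Bounded weighted shifts\<close>

locale bounded_weighted_shift = directed_tree V E
  for V :: "'v set" and E :: "('v \<times> 'v) set" +
  fixes lam :: "'v \<Rightarrow> complex"
  assumes bounded: "bounded_operator V (weighted_shift_dom V E lam) (weighted_shift V E lam)"
begin

section \<open>Action of the shift on siblings and on basis vectors\<close>

abbreviation S :: "('v \<Rightarrow> complex) \<Rightarrow> 'v \<Rightarrow> complex" where
  "S \<equiv> weighted_shift V E lam"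

text \<open>These numbers are the diagonal of \<open>S* S\<close>, which acts on \<open>l2 V\<close>
  as multiplication by \<open>n\<close>.\<close>

abbreviation n :: "'v \<Rightarrow> real" where
  "n u \<equiv> (l2_norm V (S (indicator {u})))\<^sup>2"

lemma S_in_l2: "f \<in> l2 V \<Longrightarrow> S f \<in> l2 V"
  using bounded by (simp add: bounded_operator_def)

lemma S_Chi: "w \<in> Chi E u \<Longrightarrow> S f w = lam w * f u"
  using child_not_root[of w u] par_Chi[of w u] by (simp add: weighted_shift_def)

lemma S_roots: "v \<notin> V - roots V E \<Longrightarrow> S f v = 0"
  unfolding weighted_shift_def by (simp only: if_False)

lemma S_indicator: "S (indicator {u}) v = (if v \<in> Chi E u then lam v else 0)"
  by (auto simp: weighted_shift_def in_Chi_iff indicator_def)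

lemma indicator_in_l2: "u \<in> V \<Longrightarrow> indicator {u} \<in> l2 V"
  by (intro finite_support_in_l2[of "{u}"]) auto

text \<open>Since the domain is all of \<open>l2 V\<close>, the image of a basis vector is square
  summable, and its values on \<open>Chi E u\<close> are the weights.\<close>

lemma weights_summable:
  assumes "u \<in> V"
  shows "(\<lambda>w. (cmod (lam w))\<^sup>2) summable_on Chi E u"
proof -
  have "(\<lambda>w. (cmod (S (indicator {u}) w))\<^sup>2) summable_on Chi E u"
    using assms by (intro l2_summable[of _ V] S_in_l2 indicator_in_l2 Chi_subset)
  then show ?thesis
    by (rule summable_on_cong[THEN iffD1, rotated]) (simp add: S_indicator)
qed

lemma n_eq: "n u = (\<Sum>\<^sub>\<infinity>w\<in>Chi E u. (cmod (lam w))\<^sup>2)"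
  unfolding l2_norm_squared
  using Chi_subset[of u] by (intro infsum_cong_neutral) (auto simp: S_indicator)

text \<open>The operator bound is applied to unit basis vectors. Uniformity in \<open>u\<close> is
  what later keeps the adjoint inside \<open>l2 V\<close>.\<close>

lemma n_bounded: obtains K where "\<And>u. u \<in> V \<Longrightarrow> n u \<le> K"
proof -
  obtain C where C: "\<And>f. f \<in> l2 V \<Longrightarrow> l2_norm V (S f) \<le> C * l2_norm V f"
    using bounded unfolding bounded_operator_def by metis
  have "n u \<le> C\<^sup>2" if "u \<in> V" for u
    using C[OF indicator_in_l2[OF that]] l2_norm_indicator[OF that]
    by (intro power_mono) (auto simp: l2_norm_nonneg)
  then show ?thesis by (rule that)
qed

text \<open>On the children of \<open>u\<close>, the vector \<open>S f\<close> is \<open>f u\<close>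
  times the weights, so grouping by parent pulls out the factor |f u|^2 and leaves
  \<open>n u\<close>.\<close>

lemma
  assumes f: "f \<in> l2 V"
  shows norm_S_squared: "(l2_norm V (S f))\<^sup>2 = (\<Sum>\<^sub>\<infinity>u\<in>V. n u * (cmod (f u))\<^sup>2)"
    and norm_S_summable: "(\<lambda>u. n u * (cmod (f u))\<^sup>2) summable_on V"
proof -
  let ?\<phi> = "\<lambda>v. (cmod (S f v))\<^sup>2"
  have s: "?\<phi> summable_on V - roots V E"
    using S_in_l2[OF f] by (intro l2_summable) auto
  have n: "(\<Sum>\<^sub>\<infinity>w\<in>Chi E u. ?\<phi> w) = n u * (cmod (f u))\<^sup>2" for u
  proof -
    have "(\<Sum>\<^sub>\<infinity>w\<in>Chi E u. ?\<phi> w) = (\<Sum>\<^sub>\<infinity>w\<in>Chi E u. (cmod (lam w))\<^sup>2 * (cmod (f u))\<^sup>2)"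
      by (intro infsum_cong) (simp add: S_Chi norm_mult power_mult_distrib)
    then show ?thesis
      by (simp add: n_eq infsum_cmult_left')
  qed
  have "(l2_norm V (S f))\<^sup>2 = infsum ?\<phi> (V - roots V E)"
    unfolding l2_norm_squared by (intro infsum_cong_neutral) (auto simp: S_roots)
  then show "(l2_norm V (S f))\<^sup>2 = (\<Sum>\<^sub>\<infinity>u\<in>V. n u * (cmod (f u))\<^sup>2)"
    using infsum_siblings[OF s] by (simp add: n)
  show "(\<lambda>u. n u * (cmod (f u))\<^sup>2) summable_on V"
    using summable_on_siblings[OF s] by (simp add: n)
qed

section \<open>The adjoint\<close>

definition adj :: "('v \<Rightarrow> complex) \<Rightarrow> 'v \<Rightarrow> complex" where
  "adj f u = (\<Sum>\<^sub>\<infinity>w\<in>Chi E u. cnj (lam w) * f w)"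

text \<open>Cauchy-Schwarz on each sibling set bounds |adj f u|^2 by \<open>n u\<close> times the
  mass of \<open>f\<close> there. With \<open>n\<close> bounded, these masses add up to at most the
  squared norm of \<open>f\<close>.\<close>

lemma adj_in_l2:
  assumes f: "f \<in> l2 V"
  shows "adj f \<in> l2 V"
proof -
  obtain K where K: "\<And>u. u \<in> V \<Longrightarrow> n u \<le> K"
    using n_bounded by blast
  have "(\<lambda>u. (cmod (adj f u))\<^sup>2) summable_on V"
  proof (rule summable_on_comparison_test)
    show "(\<lambda>u. K * (\<Sum>\<^sub>\<infinity>w\<in>Chi E u. (cmod (f w))\<^sup>2)) summable_on V"
      by (intro summable_on_cmult_right summable_on_siblings l2_summable[OF f] Diff_subset)
    show "(cmod (adj f u))\<^sup>2 \<le> K * (\<Sum>\<^sub>\<infinity>w\<in>Chi E u. (cmod (f w))\<^sup>2)" if "u \<in> V" for u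
    proof -
      have "(cmod (adj f u))\<^sup>2 \<le> n u * (\<Sum>\<^sub>\<infinity>w\<in>Chi E u. (cmod (f w))\<^sup>2)"
        using infsum_Cauchy_Schwarz_complex[of "\<lambda>w. cnj (lam w)" "Chi E u" f]
          weights_summable[OF that] l2_summable[OF f Chi_subset]
        by (simp add: adj_def n_eq)
      also have "\<dots> \<le> K * (\<Sum>\<^sub>\<infinity>w\<in>Chi E u. (cmod (f w))\<^sup>2)"
        using K[OF that] by (intro mult_right_mono infsum_nonneg) auto
      finally show ?thesis .
    qed
  qed simp
  moreover have "adj f u = 0" if "u \<notin> V" for u
  proof -
    have "Chi E u = {}" using parent_in_tree that by blast
    then show ?thesis by (simp add: adj_def)
  qed
  ultimately show ?thesis by (simp add: l2_def)
qed

text \<open>In the inner product grouped by parent, \<open>h u\<close> factors out of the sum over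
  the children of \<open>u\<close>; what remains is the conjugate of \<open>adj f u\<close>.\<close>

lemma l2_adjoint_S:
  assumes f: "f \<in> l2 V"
  shows "l2_adjoint V S f = adj f"
proof (rule l2_adjoint_eqI[OF adj_in_l2[OF f]])
  fix h assume h: "h \<in> l2 V"
  let ?\<phi> = "\<lambda>v. S h v * cnj (f v)"
  have s: "?\<phi> summable_on V - roots V E"
    using l2_summable[OF S_in_l2[OF h]] l2_summable[OF f]
    by (intro summable_on_mult_complex) auto
  have "(\<Sum>\<^sub>\<infinity>w\<in>Chi E u. ?\<phi> w) = h u * cnj (adj f u)" for u
  proof -
    have "(\<Sum>\<^sub>\<infinity>w\<in>Chi E u. ?\<phi> w) = (\<Sum>\<^sub>\<infinity>w\<in>Chi E u. h u * cnj (cnj (lam w) * f w))"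
      by (intro infsum_cong) (simp add: S_Chi)
    also have "\<dots> = h u * cnj (adj f u)"
      unfolding adj_def infsum_cnj[symmetric] by (rule infsum_cmult_right')
    finally show ?thesis .
  qed
  moreover have "l2_inner V (S h) f = infsum ?\<phi> (V - roots V E)"
    unfolding l2_inner_def by (intro infsum_cong_neutral) (auto simp: S_roots)
  ultimately show "l2_inner V (S h) f = l2_inner V h (adj f)"
    using infsum_siblings[OF s] by (simp add: l2_inner_def)
qed

section \<open>Hyponormality as an inequality of sums, and its consequences for the weights\<close>

lemma hyponormal_iff:
  "hyponormal V S \<longleftrightarrow>
    (\<forall>f\<in>l2 V. (\<Sum>\<^sub>\<infinity>u\<in>V. (cmod (adj f u))\<^sup>2) \<le> (\<Sum>\<^sub>\<infinity>u\<in>V. n u * (cmod (f u))\<^sup>2))"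
proof -
  have "l2_norm V (l2_adjoint V S f) \<le> l2_norm V (S f) \<longleftrightarrow>
      (\<Sum>\<^sub>\<infinity>u\<in>V. (cmod (adj f u))\<^sup>2) \<le> (\<Sum>\<^sub>\<infinity>u\<in>V. n u * (cmod (f u))\<^sup>2)" if f: "f \<in> l2 V" for f
    unfolding l2_adjoint_S[OF f] norm_S_squared[OF f, symmetric] l2_norm_squared[of V "adj f", symmetric]
    by (simp add: power_mono_iff l2_norm_nonneg)
  then show ?thesis by (simp add: hyponormal_def)
qed

text \<open>All terms on the left are nonnegative, so a single one may be kept. Nothing is lost for
  test vectors supported on the children of one \<open>u\<close>, as their adjoint image vanishes at
  all other vertices.\<close>

lemma hyponormal_pointwise:
  assumes "hyponormal V S" and f: "f \<in> l2 V" and u: "u \<in> V"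
  shows "(cmod (adj f u))\<^sup>2 \<le> (\<Sum>\<^sub>\<infinity>v\<in>V. n v * (cmod (f v))\<^sup>2)"
proof -
  have "(cmod (adj f u))\<^sup>2 \<le> (\<Sum>\<^sub>\<infinity>u\<in>V. (cmod (adj f u))\<^sup>2)"
    using finite_sum_le_infsum[OF l2_summable[OF adj_in_l2[OF f] order_refl], of "{u}"] u by simp
  with assms(1) f show ?thesis
    unfolding hyponormal_iff by (meson order_trans)
qed

text \<open>The test vector is \<open>indicator {v}\<close>: its adjoint image at \<open>u\<close>
  is \<open>cnj (lam v)\<close>, while the right side is \<open>n v = 0\<close>.\<close>

lemma hyponormal_imp_weight_zero:
  assumes "hyponormal V S" and v: "v \<in> Chi E u" and "n v = 0"
  shows "lam v = 0"
proof -
  have V: "u \<in> V" "v \<in> V"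
    using v parent_in_tree Chi_subset by auto
  have "adj (indicator {v}) u = cnj (lam v)"
    using infsum_indicator[OF v, of "\<lambda>w. cnj (lam w)"] by (simp add: adj_def mult.commute)
  moreover have "(\<Sum>\<^sub>\<infinity>w\<in>V. n w * (cmod (indicator {v} w))\<^sup>2) = n v"
    using V infsum_finite_support[of "{v}" V "\<lambda>w. n w * (cmod (indicator {v} w))\<^sup>2"] by simp
  ultimately show ?thesis
    using hyponormal_pointwise[OF assms(1) indicator_in_l2[OF V(2)] V(1)] assms(3) by simp
qed

text \<open>The test vector gives equality in the weighted Cauchy-Schwarz inequality:
  \<open>adj f u\<close> and the weighted sum of |f v|^2 are both \<open>s\<close>, so hyponormality
  reads s^2 \<le> s. Finiteness of \<open>F\<close> places \<open>f\<close> in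
  \<open>l2 V\<close>.\<close>

lemma hyponormal_imp_sum_le_one:
  assumes "hyponormal V S" and "u \<in> V" and F: "finite F" "F \<subseteq> Chi_plus V E lam u"
  shows "(\<Sum>v\<in>F. (cmod (lam v))\<^sup>2 / n v) \<le> 1"
proof -
  define f where "f v = (if v \<in> F then lam v / of_real (n v) else 0)" for v
  define s where "s = (\<Sum>v\<in>F. (cmod (lam v))\<^sup>2 / n v)"
  have FC: "F \<subseteq> Chi E u" and pos: "\<And>v. v \<in> F \<Longrightarrow> n v > 0"
    using F by (auto simp: Chi_plus_def)
  have FV: "F \<subseteq> V"
    using FC Chi_subset by blast
  have "s \<ge> 0"
    unfolding s_def by (intro sum_nonneg) simp
  have "adj f u = (\<Sum>v\<in>F. cnj (lam v) * f v)"
    unfolding adj_def using F FC by (intro infsum_finite_support) (auto simp: f_def)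
  also have "\<dots> = of_real s"
    unfolding s_def of_real_sum
  proof (intro sum.cong refl)
    fix v assume "v \<in> F"
    then have "cnj (lam v) * f v = cnj (lam v) * lam v / of_real (n v)"
      by (simp add: f_def)
    then show "cnj (lam v) * f v = of_real ((cmod (lam v))\<^sup>2 / n v)"
      by (simp only: of_real_divide of_real_power complex_norm_square[symmetric] mult.commute[of "cnj (lam v)"])
  qed
  finally have adj: "(cmod (adj f u))\<^sup>2 = s\<^sup>2"
    using \<open>s \<ge> 0\<close> by simp
  have cancel: "m * (c / m\<^sup>2) = c / m" if "m > 0" for m c :: real
    using that by (simp add: power2_eq_square)
  have "(\<Sum>\<^sub>\<infinity>v\<in>V. n v * (cmod (f v))\<^sup>2) = (\<Sum>v\<in>F. n v * (cmod (f v))\<^sup>2)"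
    using F(1) FV by (intro infsum_finite_support) (auto simp: f_def)
  also have "\<dots> = s"
    unfolding s_def
  proof (intro sum.cong refl)
    fix v assume v: "v \<in> F"
    then have "(cmod (f v))\<^sup>2 = (cmod (lam v))\<^sup>2 / (n v)\<^sup>2"
      by (simp add: f_def norm_divide norm_power power_divide)
    then show "n v * (cmod (f v))\<^sup>2 = (cmod (lam v))\<^sup>2 / n v"
      using cancel[OF pos[OF v]] by presburger
  qed
  finally have norm: "(\<Sum>\<^sub>\<infinity>v\<in>V. n v * (cmod (f v))\<^sup>2) = s" .
  have "f \<in> l2 V"
    using F(1) FV by (rule finite_support_in_l2) (simp add: f_def)
  from hyponormal_pointwise[OF assms(1) this assms(2)] have "s\<^sup>2 \<le> s"
    unfolding adj norm .
  then have "s \<le> 1"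
    using \<open>s \<ge> 0\<close> by (cases "s = 0") (auto simp: power2_eq_square)
  then show ?thesis
    by (simp only: s_def)
qed

text \<open>The finite form of condition (ii) yields an estimate on each sibling set; disjointness
  of these sets allows summing it over all parents.\<close>

lemma hyponormalI:
  assumes zero: "\<And>u v. v \<in> Chi E u \<Longrightarrow> n v = 0 \<Longrightarrow> lam v = 0"
    and le: "\<And>u F. u \<in> V \<Longrightarrow> finite F \<Longrightarrow> F \<subseteq> Chi_plus V E lam u \<Longrightarrow>
      (\<Sum>v\<in>F. (cmod (lam v))\<^sup>2 / n v) \<le> 1"
  shows "hyponormal V S"
  unfolding hyponormal_iff
proof
  fix f assume f: "f \<in> l2 V"
  let ?\<phi> = "\<lambda>w. n w * (cmod (f w))\<^sup>2"
  have s: "?\<phi> summable_on A" if "A \<subseteq> V" for A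
    using norm_S_summable[OF f] that by (rule summable_on_subset_banach)
  have "(cmod (adj f u))\<^sup>2 \<le> (\<Sum>\<^sub>\<infinity>w\<in>Chi E u. ?\<phi> w)" if u: "u \<in> V" for u
  proof -
    \<comment> \<open>The factor \<open>sqrt (n w)\<close> is moved to \<open>f w\<close> so that
      the squares of \<open>?b\<close> are the terms of the target sum. If \<open>n w = 0\<close>,
      division by zero makes \<open>?a w = 0\<close>; this agrees with \<open>lam w = 0\<close> from
      \<open>zero\<close>, so the product is still \<open>cnj (lam w) * f w\<close>.\<close>
    let ?a = "\<lambda>w. cnj (lam w) / of_real (sqrt (n w))" and ?b = "\<lambda>w. of_real (sqrt (n w)) * f w"
    have a2: "(cmod (?a w))\<^sup>2 = (cmod (lam w))\<^sup>2 / n w" for w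
      by (simp add: norm_divide power_divide)
    have b2: "(cmod (?b w))\<^sup>2 = ?\<phi> w" for w
      by (simp add: norm_mult power_mult_distrib)
    have le_F: "(\<Sum>w\<in>F. (cmod (?a w))\<^sup>2) \<le> 1" if F: "finite F" "F \<subseteq> Chi E u" for F
    proof -
      have "(\<Sum>w\<in>F. (cmod (?a w))\<^sup>2) = (\<Sum>w\<in>F \<inter> Chi_plus V E lam u. (cmod (lam w))\<^sup>2 / n w)"
        unfolding a2 using F l2_norm_nonneg
        by (intro sum.mono_neutral_right) (auto simp: Chi_plus_def less_le)
      also have "\<dots> \<le> 1"
        using F by (intro le[OF u]) auto
      finally show ?thesis .
    qed
    \<comment> \<open>The uniform bound on finite sums gives summability itself, which
      Cauchy-Schwarz and the passage to the infinite sum require.\<close>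
    have a: "(\<lambda>w. (cmod (?a w))\<^sup>2) summable_on Chi E u"
      using le_F by (intro nonneg_bdd_above_summable_on bdd_aboveI[where M = 1]) auto
    have b: "(\<lambda>w. (cmod (?b w))\<^sup>2) summable_on Chi E u"
      unfolding b2 by (rule s[OF Chi_subset])
    have "adj f u = (\<Sum>\<^sub>\<infinity>w\<in>Chi E u. ?a w * ?b w)"
      unfolding adj_def using zero by (intro infsum_cong) auto
    then have "(cmod (adj f u))\<^sup>2
        \<le> (\<Sum>\<^sub>\<infinity>w\<in>Chi E u. (cmod (?a w))\<^sup>2) * (\<Sum>\<^sub>\<infinity>w\<in>Chi E u. (cmod (?b w))\<^sup>2)"
      using infsum_Cauchy_Schwarz_complex[OF a b] by simp
    also have "\<dots> \<le> 1 * (\<Sum>\<^sub>\<infinity>w\<in>Chi E u. (cmod (?b w))\<^sup>2)"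
      using le_F by (intro mult_right_mono infsum_le_finite_sums[OF a] infsum_nonneg) auto
    finally show ?thesis
      unfolding b2 by simp
  qed
  then have "(\<Sum>\<^sub>\<infinity>u\<in>V. (cmod (adj f u))\<^sup>2) \<le> (\<Sum>\<^sub>\<infinity>u\<in>V. \<Sum>\<^sub>\<infinity>w\<in>Chi E u. ?\<phi> w)"
    by (intro infsum_mono l2_summable[OF adj_in_l2[OF f]] summable_on_siblings s) auto
  also have "\<dots> = infsum ?\<phi> (V - roots V E)"
    by (intro infsum_siblings s) auto
  \<comment> \<open>Passing from the non-root vertices to all of \<open>V\<close> only adds
    nonnegative terms at roots.\<close>
  also have "\<dots> \<le> infsum ?\<phi> V"
    by (intro infsum_mono_neutral s) auto
  finally show "(\<Sum>\<^sub>\<infinity>u\<in>V. (cmod (adj f u))\<^sup>2) \<le> infsum ?\<phi> V" .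
qed

end

theorem theorem5p1p2:
  fixes V :: "'v set" and E :: "('v \<times> 'v) set" and lam :: "'v \<Rightarrow> complex"
  assumes "directed_tree V E"
    and "bounded_operator V (weighted_shift_dom V E lam) (weighted_shift V E lam)"
  shows "hyponormal V (weighted_shift V E lam) \<longleftrightarrow>
    (\<forall>u\<in>V.
      (\<forall>v. v \<in> Chi E u \<and> l2_norm V (weighted_shift V E lam (indicator {v})) = 0
        \<longrightarrow> lam v = 0) \<and>
      (\<Sum>\<^sub>\<infinity>v\<in>Chi_plus V E lam u.
        ennreal ((cmod (lam v))\<^sup>2 /
          (l2_norm V (weighted_shift V E lam (indicator {v})))\<^sup>2)) \<le> 1)"
proof -
  interpret directed_tree V E by fact
  interpret bounded_weighted_shift V E lam
    by unfold_locales (fact assms(2))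
  have sum_iff: "(\<Sum>\<^sub>\<infinity>v\<in>Chi_plus V E lam u. ennreal ((cmod (lam v))\<^sup>2 / n v)) \<le> 1 \<longleftrightarrow>
      (\<forall>F. finite F \<and> F \<subseteq> Chi_plus V E lam u \<longrightarrow> (\<Sum>v\<in>F. (cmod (lam v))\<^sup>2 / n v) \<le> 1)" for u
    by (rule infsum_ennreal_le_one_iff) simp
  show ?thesis
    unfolding sum_iff
  proof (intro iffI ballI conjI allI impI)
    assume "\<forall>u\<in>V. (\<forall>v. v \<in> Chi E u \<and> l2_norm V (S (indicator {v})) = 0 \<longrightarrow> lam v = 0) \<and>
      (\<forall>F. finite F \<and> F \<subseteq> Chi_plus V E lam u \<longrightarrow> (\<Sum>v\<in>F. (cmod (lam v))\<^sup>2 / n v) \<le> 1)"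
    \<comment> \<open>\<open>hyponormalI\<close> asks for vanishing weights at every
      \<open>u\<close>, while the assumption covers \<open>u\<close> in \<open>V\<close>; a vertex
      with a child lies in \<open>V\<close>.\<close>
    then show "hyponormal V S"
      using parent_in_tree by (intro hyponormalI) auto
  qed (use hyponormal_imp_weight_zero hyponormal_imp_sum_le_one in auto)
qed

end
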